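(* For $n=6$ there are exactly $4$ balanced choice functions with zigzag chromatic form, and for $n=12$ there are exactly $48$. For each of these choice functions $F$ (with $F(T_k)=(a_k,b_k)$) the closure sum $\sum_{k=2}^{n-2} a_k \bmod n$ is nonzero; for $n=12$ the $48$ closure sums realize every nonzero residue modulo $12$. Hence $B(6)=B(12)=0$, i.e. there are no zigzag trichord cycles in $\mathbb{Z}_6$ or in $\mathbb{Z}_{12}$.
   Context: Let $n\ge 6$. For $2\le k\le n-2$ let $T_k$ be the transposition class of $\{0,1,k\}\subset\mathbb{Z}_n$. The six forms of $T_k$ are the ordered pairs in $\mathbb{Z}_n^2$: $\mathrm{I}=(1,k-1)$, $\mathrm{II}=(k,1-k)$, $\mathrm{III}=(-1,k)$, $\mathrm{IV}=(k-1,-k)$, $\mathrm{V}=(-k,1)$, $\mathrm{VI}=(1-k,-1)$. A choice function $F$ assigns to each $T_k$, $2\le k\le n-2$, one of its six forms $F(T_k)=(a_k,b_k)$, viewed as a directed edge $a_k\to b_k$ on the node set $\mathbb{Z}_n\setminus\{0\}$. $F$ is balanced if at every node the in-degree equals the out-degree (each $x$ occurs as often among the $a_k$ as among the $b_k$). $F$ has zigzag chromatic form if $F(T_2)$ is one of the forms II, III, IV, V of $T_2$, i.e. $F(T_2)\in\{(2,-1),(-1,2),(1,-2),(-2,1)\}$. A trichord cycle in $\mathbb{Z}_n$ is a cyclic word $c_0\cdots c_{m-1}$ over $\mathbb{Z}_n$, $m=n-3$ (letters may repeat), whose windows $\{c_i,c_{i+1},c_{i+2}\}$ (indices mod $m$)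 are three-element sets such that each $T_k$, $2\le k\le n-2$, contains exactly one window. It is scalar if the ordered triple of the window in $T_2$ is a translate of $(0,1,2)$ or $(2,1,0)$, and zigzag otherwise. $B(n)$ is the number of zigzag cycles with $c_0=0$. *)

theory Defs
  imports Main "HOL-Library.FuncSet"
begin

text \<open>The ring of integers modulo \<open>n\<close> is represented by the canonical residues
  \<open>{0..<n}\<close> in \<open>int\<close>, every arithmetic result being reduced modulo \<open>n\<close>.\<close>

definition Zmod :: "nat \<Rightarrow> int set" where
  "Zmod n = {0..<int n}"

text \<open>The set of all translates of \<open>{0, 1, k}\<close>.\<close>

definition transposition_class :: "nat \<Rightarrow> int \<Rightarrow> int set set" where
  "transposition_class n k = (\<lambda>t. (\<lambda>x. (x + t) mod int n) ` {0, 1, k}) ` Zmod n"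

definition class_indices :: "nat \<Rightarrow> int set" where
  "class_indices n = {2..int n - 2}"

datatype form_label = Form_I | Form_II | Form_III | Form_IV | Form_V | Form_VI

fun form :: "nat \<Rightarrow> int \<Rightarrow> form_label \<Rightarrow> int \<times> int" where
  "form n k Form_I   = (1 mod int n, (k - 1) mod int n)"
| "form n k Form_II  = (k mod int n, (1 - k) mod int n)"
| "form n k Form_III = ((-1) mod int n, k mod int n)"
| "form n k Form_IV  = ((k - 1) mod int n, (-k) mod int n)"
| "form n k Form_V   = ((-k) mod int n, 1 mod int n)"
| "form n k Form_VI  = ((1 - k) mod int n, (-1) mod int n)"

text \<open>A choice function takes the classes themselves as arguments; \<open>extensional\<close> fixes its
  value off the set of classes, so that choice functions can be counted.\<close>

definition choice_function :: "nat \<Rightarrow> (int set set \<Rightarrow> int \<times> int) \<Rightarrow> bool" where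
  "choice_function n F \<longleftrightarrow>
     F \<in> extensional (transposition_class n ` class_indices n) \<and>
     (\<forall>k\<in>class_indices n. F (transposition_class n k) \<in> range (form n k))"

definition edge_source :: "nat \<Rightarrow> (int set set \<Rightarrow> int \<times> int) \<Rightarrow> int \<Rightarrow> int" where
  "edge_source n F k = fst (F (transposition_class n k))"

definition edge_target :: "nat \<Rightarrow> (int set set \<Rightarrow> int \<times> int) \<Rightarrow> int \<Rightarrow> int" where
  "edge_target n F k = snd (F (transposition_class n k))"

definition out_degree :: "nat \<Rightarrow> (int set set \<Rightarrow> int \<times> int) \<Rightarrow> int \<Rightarrow> nat" where
  "out_degree n F x = card {k \<in> class_indices n. edge_source n F k = x}"

definition in_degree :: "nat \<Rightarrow> (int set set \<Rightarrow> int \<times> int) \<Rightarrow> int \<Rightarrow> nat" where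
  "in_degree n F x = card {k \<in> class_indices n. edge_target n F k = x}"

definition balanced :: "nat \<Rightarrow> (int set set \<Rightarrow> int \<times> int) \<Rightarrow> bool" where
  "balanced n F \<longleftrightarrow> (\<forall>x \<in> Zmod n - {0}. in_degree n F x = out_degree n F x)"

definition zigzag_chromatic :: "nat \<Rightarrow> (int set set \<Rightarrow> int \<times> int) \<Rightarrow> bool" where
  "zigzag_chromatic n F \<longleftrightarrow>
     F (transposition_class n 2) \<in> form n 2 ` {Form_II, Form_III, Form_IV, Form_V}"

definition balanced_zigzag_choices :: "nat \<Rightarrow> (int set set \<Rightarrow> int \<times> int) set" where
  "balanced_zigzag_choices n = {F. choice_function n F \<and> balanced n F \<and> zigzag_chromatic n F}"

definition closure_sum :: "nat \<Rightarrow> (int set set \<Rightarrow> int \<times> int) \<Rightarrow> int" where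
  "closure_sum n F = (\<Sum>k\<in>class_indices n. edge_source n F k) mod int n"

text \<open>A cyclic word is given by the list \<open>[c\<^sub>0, \<dots>, c\<^sub>m\<^sub>-\<^sub>1]\<close>, with positions read
  modulo its length.\<close>

definition window_triple :: "int list \<Rightarrow> nat \<Rightarrow> int \<times> int \<times> int" where
  "window_triple c i =
     (c ! (i mod length c), c ! ((i + 1) mod length c), c ! ((i + 2) mod length c))"

definition window :: "int list \<Rightarrow> nat \<Rightarrow> int set" where
  "window c i = (case window_triple c i of (x, y, z) \<Rightarrow> {x, y, z})"

definition trichord_cycle :: "nat \<Rightarrow> int list \<Rightarrow> bool" where
  "trichord_cycle n c \<longleftrightarrow>
     length c = n - 3 \<and> set c \<subseteq> Zmod n \<and>
     (\<forall>i < n - 3. card (window c i) = 3) \<and>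
     (\<forall>k \<in> class_indices n. \<exists>!i. i < n - 3 \<and> window c i \<in> transposition_class n k)"

definition translate_triple :: "nat \<Rightarrow> int \<Rightarrow> int \<times> int \<times> int \<Rightarrow> int \<times> int \<times> int" where
  "translate_triple n t = (\<lambda>(x, y, z). ((x + t) mod int n, (y + t) mod int n, (z + t) mod int n))"

text \<open>In a trichord cycle exactly one window lies in the class of \<open>{0, 1, 2}\<close>, so the
  existential quantifier over \<open>i\<close> speaks about that window.\<close>

definition scalar_cycle :: "nat \<Rightarrow> int list \<Rightarrow> bool" where
  "scalar_cycle n c \<longleftrightarrow> trichord_cycle n c \<and>
     (\<exists>i < n - 3. window c i \<in> transposition_class n 2 \<and>
        (\<exists>t \<in> Zmod n. window_triple c i = translate_triple n t (0, 1, 2) \<or>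
                      window_triple c i = translate_triple n t (2, 1, 0)))"

definition zigzag_cycle :: "nat \<Rightarrow> int list \<Rightarrow> bool" where
  "zigzag_cycle n c \<longleftrightarrow> trichord_cycle n c \<and> \<not> scalar_cycle n c"

definition B :: "nat \<Rightarrow> nat" where
  "B n = card {c. zigzag_cycle n c \<and> c ! 0 = 0}"

end

theory Submission
  imports Defs
begin

text \<open>The differences of consecutive letters of a zigzag cycle form a closed walk, which yields a
  balanced choice function of zigzag chromatic form whose closure sum telescopes to \<open>0\<close>. For
  \<open>n = 6\<close> and \<open>n = 12\<close> an exhaustive search shows that no such choice function exists. The search
  stays small because a node \<open>x\<close> other than \<open>1\<close> and \<open>- 1\<close> is touched only by the forms of at most four
  classes, those of index \<open>x\<close>, \<open>- x\<close>, \<open>x + 1\<close> and \<open>1 - x\<close>. When the classes are chosen in the order \<open>2\<close>,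
  then \<open>k\<close> and \<open>n + 1 - k\<close> for \<open>k = 3, 4, \<dots>\<close>, balance at most nodes can be tested early.\<close>

section \<open>Exhaustive search for balanced edge lists\<close>

definition balanced_at :: "('v \<times> 'v) list \<Rightarrow> 'v \<Rightarrow> bool" where
  "balanced_at es x \<longleftrightarrow> count_list (map fst es) x = count_list (map snd es) x"

lemma balanced_at_append_untouched:
  assumes "\<And>e. e \<in> set gs \<Longrightarrow> fst e \<noteq> x \<and> snd e \<noteq> x"
  shows "balanced_at (es @ gs) x \<longleftrightarrow> balanced_at es x"
proof -
  have "count_list (map fst gs) x = 0" "count_list (map snd gs) x = 0"
    using assms by (auto simp: count_list_0_iff)
  then show ?thesis by (simp add: balanced_at_def)
qed

text \<open>Each stage \<open>(cs, W)\<close> of a search lists the candidates for the next edge and the nodes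
  that no later candidate touches, so that balance at \<open>W\<close> can be tested at once.\<close>

function search ::
  "('v \<times> 'v) list \<Rightarrow> (('v \<times> 'v) list \<times> 'v list) list \<Rightarrow> ('v \<times> 'v) list list" where
  "search es [] = [es]"
| "search es (([], W) # st) = []"
| "search es ((e # cs, W) # st) =
     (if list_all (balanced_at (es @ [e])) W then search (es @ [e]) st else []) @
     search es ((cs, W) # st)"
  by pat_completeness auto
termination by (relation "measure (\<lambda>(_, st). \<Sum>(cs, _)\<leftarrow>st. Suc (length cs))") auto

text \<open>Avoiding the nodes of \<open>W\<close> in all later candidates makes an early balance
  test final; distinct candidates keep a result from being listed twice.\<close>

fun admissible :: "(('v \<times> 'v) list \<times> 'v list) list \<Rightarrow> bool" where
  "admissible [] \<longleftrightarrow> True"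
| "admissible ((cs, W) # st) \<longleftrightarrow>
     distinct cs \<and> admissible st \<and>
     list_all (\<lambda>(ds, _). list_all (\<lambda>(a, b). a \<notin> set W \<and> b \<notin> set W) ds) st"

text \<open>Pruning is sound and loses nothing: edges chosen after \<open>e\<close> come from later
  stages, whose candidates avoid \<open>W\<close>, so at the nodes of \<open>W\<close> the prefix
  \<open>es @ [e]\<close> is balanced exactly when the whole list is. The prefix \<open>es\<close>
  stays arbitrary for the induction.\<close>

lemma set_search:
  assumes "admissible st"
  shows "fs \<in> set (search es st) \<longleftrightarrow>
    (\<exists>gs. fs = es @ gs \<and> list_all2 (\<lambda>g (cs, _). g \<in> set cs) gs st \<and>
       (\<forall>(_, W) \<in> set st. \<forall>x \<in> set W. balanced_at fs x))"
  using assms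
proof (induction es st rule: search.induct)
  case (3 es e cs W st)
  have untouched: "balanced_at (es @ e # gs) x \<longleftrightarrow> balanced_at (es @ [e]) x"
    if gs: "list_all2 (\<lambda>g (cs, _). g \<in> set cs) gs st" and x: "x \<in> set W" for gs x
  proof -
    have "fst g \<noteq> x \<and> snd g \<noteq> x" if g: "g \<in> set gs" for g
    proof -
      obtain i where i: "i < length gs" "gs ! i = g"
        using g unfolding in_set_conv_nth by blast
      with gs have "g \<in> set (fst (st ! i))" "st ! i \<in> set st"
        by (auto simp: list_all2_conv_all_nth case_prod_beta)
      with 3(3) x show ?thesis
        by (cases "st ! i"; cases g) (auto simp: list_all_iff)
    qed
    then show ?thesis
      using balanced_at_append_untouched[of gs x "es @ [e]"] by simp
  qed
  let ?ok = "\<lambda>gs st. list_all2 (\<lambda>g (cs, _). g \<in> set cs) gs st \<and>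
       (\<forall>(_, W) \<in> set st. \<forall>x \<in> set W. balanced_at fs x)"
  have "fs \<in> set (search es ((e # cs, W) # st)) \<longleftrightarrow>
    (\<forall>x \<in> set W. balanced_at (es @ [e]) x) \<and> (\<exists>gs. fs = es @ e # gs \<and> ?ok gs st) \<or>
    (\<exists>gs. fs = es @ gs \<and> ?ok gs ((cs, W) # st))"
    using 3 by (simp add: list_all_iff cong: conj_cong)
  also have "\<dots> \<longleftrightarrow> (\<exists>gs. fs = es @ e # gs \<and> ?ok gs st \<and> (\<forall>x \<in> set W. balanced_at fs x)) \<or>
    (\<exists>gs. fs = es @ gs \<and> ?ok gs ((cs, W) # st))"
    using untouched by blast
  also have "\<dots> \<longleftrightarrow> (\<exists>gs. fs = es @ gs \<and> ?ok gs ((e # cs, W) # st))"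
    by (cases e) (auto simp: list_all2_Cons2)
  finally show ?case .
qed (auto simp: list_all2_Cons2)

text \<open>The two branches at a stage yield disjoint results, since right after \<open>es\<close>
  the first has \<open>e\<close> and the second a member of \<open>cs\<close>, which does not
  contain \<open>e\<close>.\<close>

lemma distinct_search: "admissible st \<Longrightarrow> distinct (search es st)"
proof (induction es st rule: search.induct)
  case (3 es e cs W st)
  have "set (search (es @ [e]) st) \<inter> set (search es ((cs, W) # st)) = {}"
    using 3(3) by (auto simp: set_search list_all2_Cons2)
  with 3 show ?case by auto
qed simp_all


section \<open>Choice functions as edge lists\<close>

lemma transposition_class_shift:
  assumes "n > 0"
  shows "S \<in> transposition_class n k \<longleftrightarrow> (\<exists>t. S = (\<lambda>x. (x + t) mod int n) ` {0, 1, k})"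
proof
  assume "\<exists>t. S = (\<lambda>x. (x + t) mod int n) ` {0, 1, k}"
  then obtain t where "S = (\<lambda>x. (x + t) mod int n) ` {0, 1, k}" by blast
  then have "S = (\<lambda>x. (x + t mod int n) mod int n) ` {0, 1, k}" by (simp add: mod_simps)
  moreover have "t mod int n \<in> Zmod n" using assms by (simp add: Zmod_def)
  ultimately show "S \<in> transposition_class n k" unfolding transposition_class_def by blast
qed (auto simp: transposition_class_def)

text \<open>Translating \<open>S\<close> by \<open>-t\<close> normalizes its second description to
  \<open>{0, 1, k}\<close> and leaves a shift \<open>u\<close> in the first. The bounds on
  \<open>j\<close> and \<open>k\<close> exclude \<open>u = k\<close> and \<open>u = 1\<close>, so
  \<open>u = 0\<close> and the third elements agree.\<close>

lemma transposition_class_disjoint: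
  assumes j: "j \<in> class_indices n" and k: "k \<in> class_indices n"
    and S: "S \<in> transposition_class n j" "S \<in> transposition_class n k"
  shows "j = k"
proof -
  define N where "N = int n"
  have jk: "2 \<le> j" "j \<le> N - 2" "2 \<le> k" "k \<le> N - 2"
    using j k by (auto simp: class_indices_def N_def)
  obtain s t where S1: "S = (\<lambda>x. (x + s) mod N) ` {0, 1, j}"
    and S2: "S = (\<lambda>x. (x + t) mod N) ` {0, 1, k}"
    using S by (auto simp: transposition_class_def N_def)
  define u where "u = (s - t) mod N"
  have u: "0 \<le> u" "u < N" using jk by (auto simp: u_def)
  have "(\<lambda>y. (y - t) mod N) ` S = (\<lambda>x. (x + u) mod N) ` {0, 1, j}"
    unfolding S1 u_def image_image by (simp add: mod_simps algebra_simps)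
  moreover have "(\<lambda>y. (y - t) mod N) ` S = {0, 1, k}"
    unfolding S2 image_image using jk by (simp add: mod_simps)
  ultimately have eq: "{u, (u + 1) mod N, (j + u) mod N} = {0, 1, k}"
    using u by (simp add: algebra_simps)
  then have "u \<in> {0, 1, k}" by blast
  moreover have "u \<noteq> k"
  proof
    assume "u = k"
    then have "{k, k + 1, (j + k) mod N} = {0, 1, k}" using eq jk by simp
    then have "k + 1 \<in> {0, 1, k}" by blast
    then show False using jk by auto
  qed
  \<comment> \<open>For \<open>u = 1\<close> the element 0 could only be \<open>j + 1\<close>,
    forcing \<open>j = -1\<close> modulo \<open>n\<close>, just outside the range of
    indices.\<close>
  moreover have "u \<noteq> 1"
  proof
    assume "u = 1"
    then have "{1, 2, j + 1} = {0, 1, k}" using eq jk by (simp add: algebra_simps)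
    then have "0 \<in> {1, 2, j + 1}" by simp
    then show False using jk by auto
  qed
  ultimately have "{0, 1, j} = {0, 1, k}" using eq jk by simp
  then have "j \<in> {0, 1, k}" by blast
  then show ?thesis using jk by auto
qed

lemma inj_on_transposition_class: "inj_on (transposition_class n) (class_indices n)"
proof (rule inj_onI)
  fix j k
  assume jk: "j \<in> class_indices n" "k \<in> class_indices n"
    and eq: "transposition_class n j = transposition_class n k"
  have "n > 0" using jk by (auto simp: class_indices_def)
  then have "(\<lambda>x. (x + 0) mod int n) ` {0, 1, j} \<in> transposition_class n j"
    using transposition_class_shift by blast
  then show "j = k" using transposition_class_disjoint[OF jk] eq by blast
qed

text \<open>Choice functions take classes as arguments; as distinct indices give distinct classes,
  values may be prescribed by index instead.\<close>

lemma choice_on_classes: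
  obtains F where "F \<in> extensional (transposition_class n ` class_indices n)"
    "\<And>k. k \<in> class_indices n \<Longrightarrow> F (transposition_class n k) = \<phi> k"
proof
  let ?T = "transposition_class n" and ?C = "class_indices n"
  let ?F = "restrict (\<lambda>X. \<phi> (inv_into ?C ?T X)) (?T ` ?C)"
  show "?F \<in> extensional (?T ` ?C)" by simp
  show "?F (?T k) = \<phi> k" if "k \<in> ?C" for k
    using that by (simp add: inv_into_f_f[OF inj_on_transposition_class])
qed

section \<open>Edge lists along an order of the classes\<close>

text \<open>Dropping forms I and VI at index 2 builds the zigzag condition into the candidates, so
  that it needs no separate test.\<close>

definition edge_candidates :: "nat \<Rightarrow> int \<Rightarrow> (int \<times> int) list" where
  "edge_candidates n k = map (form n k)
     (if k = 2 then [Form_II, Form_III, Form_IV, Form_V]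
      else [Form_I, Form_II, Form_III, Form_IV, Form_V, Form_VI])"

lemma choice_zigzag_iff:
  assumes "n \<ge> 4"
  shows "choice_function n F \<and> zigzag_chromatic n F \<longleftrightarrow>
    F \<in> extensional (transposition_class n ` class_indices n) \<and>
    (\<forall>k \<in> class_indices n. F (transposition_class n k) \<in> set (edge_candidates n k))"
proof -
  have "range (form n k) = form n k ` {Form_I, Form_II, Form_III, Form_IV, Form_V, Form_VI}" for k
    by (rule arg_cong[where f = "image (form n k)"]) (auto intro: form_label.exhaust)
  moreover have "2 \<in> class_indices n" using assms by (simp add: class_indices_def)
  ultimately show ?thesis
    unfolding choice_function_def zigzag_chromatic_def edge_candidates_def by auto
qed

text \<open>An entry \<open>(k, W)\<close> of the order \<open>s\<close> means: choose an edge for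
  the class of index \<open>k\<close>, then test balance at the nodes \<open>W\<close>.\<close>

definition schedule :: "nat \<Rightarrow> (int \<times> int list) list \<Rightarrow> ((int \<times> int) list \<times> int list) list" where
  "schedule n s = map (\<lambda>(k, W). (edge_candidates n k, W)) s"

definition choice_list ::
  "nat \<Rightarrow> (int \<times> int list) list \<Rightarrow> (int set set \<Rightarrow> int \<times> int) \<Rightarrow> (int \<times> int) list" where
  "choice_list n s F = map (\<lambda>(k, _). F (transposition_class n k)) s"

text \<open>Because the tested nodes exhaust the nonzero residues, passing all tests of the search
  amounts to \<open>balanced\<close>.\<close>

definition complete_order :: "nat \<Rightarrow> (int \<times> int list) list \<Rightarrow> bool" where
  "complete_order n s \<longleftrightarrow> distinct (map fst s) \<and> set (map fst s) = class_indices n \<and>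
     set (concat (map snd s)) = Zmod n - {0}"

lemma card_filter_distinct_map:
  assumes "distinct (map fst s)"
  shows "card {k \<in> set (map fst s). f k = x} = count_list (map (\<lambda>(k, _). f k) s) x"
proof -
  have "card {k \<in> set (map fst s). f k = x} = length (filter (\<lambda>k. f k = x) (map fst s))"
    using assms by (metis distinct_card distinct_filter set_filter)
  also have "\<dots> = count_list (map f (map fst s)) x"
    by (simp add: count_list_eq_length_filter filter_map o_def eq_commute)
  finally show ?thesis by (simp add: case_prod_unfold o_def)
qed

lemma balanced_choice_list:
  assumes "complete_order n s"
  shows "balanced n F \<longleftrightarrow> (\<forall>x \<in> Zmod n - {0}. balanced_at (choice_list n s F) x)"
proof -
  have s: "distinct (map fst s)" "class_indices n = set (map fst s)"
    using assms by (auto simp: complete_order_def)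
  have "in_degree n F x = count_list (map snd (choice_list n s F)) x"
    "out_degree n F x = count_list (map fst (choice_list n s F)) x" for x
    unfolding in_degree_def out_degree_def s(2) card_filter_distinct_map[OF s(1)]
    by (simp_all add: choice_list_def edge_source_def edge_target_def o_def case_prod_unfold)
  then show ?thesis unfolding balanced_def balanced_at_def by metis
qed

text \<open>An extensional function is determined by its values on the classes, which gives
  injectivity; conversely a result of the search has one edge per class and can be read back as a
  choice function.\<close>

lemma bij_betw_choice_list:
  assumes n: "n \<ge> 4" and s: "complete_order n s" and adm: "admissible (schedule n s)"
  shows "bij_betw (choice_list n s) (balanced_zigzag_choices n) (set (search [] (schedule n s)))"
proof -
  let ?T = "transposition_class n" and ?C = "class_indices n"
  have C: "?C = fst ` set s" and dist: "distinct (map fst s)"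
    using s by (auto simp: complete_order_def)
  have W: "(\<forall>x \<in> Zmod n - {0}. balanced_at es x) \<longleftrightarrow>
    (\<forall>(_, W) \<in> set (schedule n s). \<forall>x \<in> set W. balanced_at es x)" for es
  proof -
    have "Zmod n - {0} = set (concat (map snd s))" using s by (simp add: complete_order_def)
    then show ?thesis by (auto simp: schedule_def case_prod_beta)
  qed
  have mem: "F \<in> balanced_zigzag_choices n \<longleftrightarrow>
    F \<in> extensional (?T ` ?C) \<and> choice_list n s F \<in> set (search [] (schedule n s))" for F
  proof -
    have "list_all2 (\<lambda>g (cs, _). g \<in> set cs) (choice_list n s F) (schedule n s) \<longleftrightarrow>
      (\<forall>k \<in> ?C. F (?T k) \<in> set (edge_candidates n k))"
      unfolding C choice_list_def schedule_def
      by (induction s) auto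
    then show ?thesis
      using choice_zigzag_iff[OF n, of F] balanced_choice_list[OF s, of F]
      unfolding balanced_zigzag_choices_def set_search[OF adm] W by auto
  qed
  show ?thesis
  proof (rule bij_betw_imageI)
    show "inj_on (choice_list n s) (balanced_zigzag_choices n)"
    proof (rule inj_onI)
      fix F G
      assume "F \<in> balanced_zigzag_choices n" "G \<in> balanced_zigzag_choices n"
        and eq: "choice_list n s F = choice_list n s G"
      then have ext: "F \<in> extensional (?T ` ?C)" "G \<in> extensional (?T ` ?C)"
        using mem by auto
      show "F = G"
        by (rule extensionalityI[OF ext]) (use eq in \<open>auto simp: C choice_list_def\<close>)
    qed
    show "choice_list n s ` balanced_zigzag_choices n = set (search [] (schedule n s))"
    proof (intro equalityI subsetI)
      fix es assume es: "es \<in> set (search [] (schedule n s))"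
      then have len: "length es = length s"
        unfolding set_search[OF adm] by (auto dest: list_all2_lengthD simp: schedule_def)
      \<comment> \<open>The preimage looks up \<open>k\<close> in \<open>es\<close> through its
        place in the order. Every index occurs there exactly once, so \<open>the\<close> always
        meets a defined value.\<close>
      obtain F where F: "F \<in> extensional (?T ` ?C)"
        "\<And>k. k \<in> ?C \<Longrightarrow> F (?T k) = the (map_of (zip (map fst s) es) k)"
        using choice_on_classes[of n "\<lambda>k. the (map_of (zip (map fst s) es) k)"] by blast
      have "choice_list n s F = es"
      proof (rule nth_equalityI)
        fix i assume "i < length (choice_list n s F)"
        then have i: "i < length s" by (simp add: choice_list_def)
        then have "map_of (zip (map fst s) es) (map fst s ! i) = Some (es ! i)"
          using map_of_zip_nth[of "map fst s" es i] dist len by simp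
        then show "choice_list n s F ! i = es ! i"
          using i F(2)[of "fst (s ! i)"] by (simp add: choice_list_def C case_prod_beta)
      qed (simp add: choice_list_def len)
      then show "es \<in> choice_list n s ` balanced_zigzag_choices n"
        using F(1) es mem by blast
    qed (use mem in blast)
  qed
qed

lemma closure_sum_choice_list:
  assumes "complete_order n s"
  shows "closure_sum n F = sum_list (map fst (choice_list n s F)) mod int n"
proof -
  have s: "distinct (map fst s)" "class_indices n = set (map fst s)"
    using assms by (auto simp: complete_order_def)
  show ?thesis
    unfolding closure_sum_def s(2) sum.distinct_set_conv_list[OF s(1)]
    by (simp add: choice_list_def edge_source_def o_def case_prod_unfold)
qed

text \<open>One evaluation settles both claims: \<open>xs\<close> keeps repeated sums, so its length
  counts the choice functions while its set gives the sums attained.\<close>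

lemma balanced_zigzag_choices_enumeration:
  assumes n: "n \<ge> 4" and s: "complete_order n s" and adm: "admissible (schedule n s)"
    and sums: "map (\<lambda>es. sum_list (map fst es) mod int n) (search [] (schedule n s)) = xs"
  shows "card (balanced_zigzag_choices n) = length xs"
    "closure_sum n ` balanced_zigzag_choices n = set xs"
proof -
  note bij = bij_betw_choice_list[OF n s adm]
  show "card (balanced_zigzag_choices n) = length xs"
    using bij_betw_same_card[OF bij] distinct_card[OF distinct_search[OF adm]] sums by auto
  show "closure_sum n ` balanced_zigzag_choices n = set xs"
    unfolding closure_sum_choice_list[OF s] sums[symmetric] set_map
      bij_betw_imp_surj_on[OF bij, symmetric] image_image ..
qed


section \<open>The choice function of a zigzag cycle\<close>

text \<open>The six orderings of a translate of \<open>{0, 1, k}\<close> have the six forms as their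
  pairs of successive differences, whatever the shift. The shift is recorded for forms I and VI, the
  orderings with 1 in the middle, since for \<open>k = 2\<close> these are the scalar ones.\<close>

lemma window_form:
  assumes "card {x, y, z} = 3" "{x, y, z} \<in> transposition_class n k"
  obtains L t where "t \<in> Zmod n"
    "((y - x) mod int n, (z - y) mod int n) = form n k L"
    "L = Form_I \<Longrightarrow> (x, y, z) = translate_triple n t (0, 1, k)"
    "L = Form_VI \<Longrightarrow> (x, y, z) = translate_triple n t (k, 1, 0)"
proof -
  obtain t where t: "t \<in> Zmod n"
    "{x, y, z} = {(0 + t) mod int n, (1 + t) mod int n, (k + t) mod int n}"
    using assms(2) by (auto simp: transposition_class_def)
  have diff: "((b + t) mod int n - (a + t) mod int n) mod int n = (b - a) mod int n" for a b
    by (simp add: mod_simps)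
  have "x \<noteq> y" "y \<noteq> z" "x \<noteq> z" using assms(1) by (auto simp: card_insert_if split: if_splits)
  then consider
      "(x, y, z) = translate_triple n t (0, 1, k)" | "(x, y, z) = translate_triple n t (0, k, 1)"
    | "(x, y, z) = translate_triple n t (1, 0, k)" | "(x, y, z) = translate_triple n t (1, k, 0)"
    | "(x, y, z) = translate_triple n t (k, 0, 1)" | "(x, y, z) = translate_triple n t (k, 1, 0)"
    using t(2) unfolding translate_triple_def set_eq_iff by simp metis
  then show ?thesis
  proof cases
    case 1 then show ?thesis
      using diff[of 1 0] diff[of k 1]
      by (intro that[of t Form_I] t) (auto simp: translate_triple_def)
  next
    case 2 then show ?thesis
      using diff[of k 0] diff[of 1 k]
      by (intro that[of t Form_II] t) (auto simp: translate_triple_def)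
  next
    case 3 then show ?thesis
      using diff[of 0 1] diff[of k 0]
      by (intro that[of t Form_III] t) (auto simp: translate_triple_def)
  next
    case 4 then show ?thesis
      using diff[of k 1] diff[of 0 k]
      by (intro that[of t Form_IV] t) (auto simp: translate_triple_def)
  next
    case 5 then show ?thesis
      using diff[of 0 k] diff[of 1 0]
      by (intro that[of t Form_V] t) (auto simp: translate_triple_def)
  next
    case 6 then show ?thesis
      using diff[of 1 k] diff[of 0 1]
      by (intro that[of t Form_VI] t) (auto simp: translate_triple_def)
  qed
qed

lemma bij_betw_Suc_mod: "bij_betw (\<lambda>i. Suc i mod m) {..<m} {..<m}"
proof (cases "m = 0")
  case False
  have "inj_on (\<lambda>i. Suc i mod m) {..<m}"
    by (rule inj_onI) (auto simp: mod_Suc split: if_splits)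
  moreover have "(\<lambda>i. Suc i mod m) ` {..<m} \<subseteq> {..<m}" using False by auto
  ultimately show ?thesis by (simp add: bij_betw_def endo_inj_surj)
qed (simp add: bij_betw_def)

lemma card_Collect_bij_betw:
  assumes "bij_betw f A A'"
  shows "card {a \<in> A. P (f a)} = card {b \<in> A'. P b}"
proof -
  have "f ` {a \<in> A. P (f a)} = {b \<in> A'. P b}" using bij_betw_imp_surj_on[OF assms] by auto
  moreover have "inj_on f {a \<in> A. P (f a)}"
    using bij_betw_imp_inj_on[OF assms] by (rule inj_on_subset) auto
  ultimately show ?thesis by (metis card_image)
qed

text \<open>A window lies in only one class, so sending a class to the position of its window is
  injective; it is onto because there are \<open>n - 3\<close> classes and \<open>n - 3\<close>
  positions.\<close>

lemma trichord_cycle_position: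
  assumes "trichord_cycle n c"
  obtains f where "bij_betw f (class_indices n) {..<n - 3}"
    "\<And>k. k \<in> class_indices n \<Longrightarrow> window c (f k) \<in> transposition_class n k"
proof -
  have "\<forall>k \<in> class_indices n. \<exists>i. i < n - 3 \<and> window c i \<in> transposition_class n k"
    using assms unfolding trichord_cycle_def by blast
  then obtain f where f: "\<And>k. k \<in> class_indices n \<Longrightarrow> f k < n - 3"
    "\<And>k. k \<in> class_indices n \<Longrightarrow> window c (f k) \<in> transposition_class n k"
    by metis
  have inj: "inj_on f (class_indices n)"
    using transposition_class_disjoint f(2) by (metis inj_onI)
  have "card (class_indices n) = n - 3" by (simp add: class_indices_def)
  then have "f ` class_indices n = {..<n - 3}"
    using f(1) card_image[OF inj] by (intro card_subset_eq) auto
  with inj f(2) show ?thesis by (intro that[of f]) (auto simp: bij_betw_def)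
qed

lemma zigzag_cycle_choice:
  assumes n: "n \<ge> 4" and c: "zigzag_cycle n c"
  obtains F where "F \<in> balanced_zigzag_choices n" "closure_sum n F = 0"
proof -
  let ?C = "class_indices n" and ?T = "transposition_class n"
  define m where "m = n - 3"
  have m: "m > 0" using n by (simp add: m_def)
  have tri: "trichord_cycle n c" and nsc: "\<not> scalar_cycle n c"
    using c by (auto simp: zigzag_cycle_def)
  have len: "length c = m" and card3: "\<And>i. i < m \<Longrightarrow> card (window c i) = 3"
    using tri by (auto simp: trichord_cycle_def m_def)
  obtain f where f: "bij_betw f ?C {..<m}" "\<And>k. k \<in> ?C \<Longrightarrow> window c (f k) \<in> ?T k"
    using trichord_cycle_position[OF tri] unfolding m_def by blast
  have f_less: "f k < m" if "k \<in> ?C" for k using f(1) that by (auto simp: bij_betw_def)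
  \<comment> \<open>\<open>d i\<close> is the step from letter \<open>i\<close> to the next one,
    periodic in \<open>i\<close> with period \<open>m\<close>. The window at \<open>i\<close> gets
    the edge from \<open>d i\<close> to \<open>d (Suc i)\<close>, so each edge ends where the edge
    of the next window starts.\<close>
  define d where "d i = (c ! (Suc i mod m) - c ! (i mod m)) mod int n" for i
  have d_mod: "d (i mod m) = d i" for i by (simp add: d_def mod_simps)
  obtain F where F: "F \<in> extensional (?T ` ?C)"
    "\<And>k. k \<in> ?C \<Longrightarrow> F (?T k) = (d (f k), d (Suc (f k)))"
    using choice_on_classes[of n "\<lambda>k. (d (f k), d (Suc (f k)))"] by blast

  have "F (?T k) \<in> set (edge_candidates n k)" if k: "k \<in> ?C" for k
  proof -
    obtain x y z where xyz: "window_triple c (f k) = (x, y, z)" by (metis prod_cases3)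
    then have w: "window c (f k) = {x, y, z}" by (simp add: window_def)
    have "card {x, y, z} = 3" "{x, y, z} \<in> ?T k"
      using card3[OF f_less[OF k]] f(2)[OF k] by (simp_all add: w)
    then obtain L t where L: "t \<in> Zmod n"
      "((y - x) mod int n, (z - y) mod int n) = form n k L"
      "L = Form_I \<Longrightarrow> (x, y, z) = translate_triple n t (0, 1, k)"
      "L = Form_VI \<Longrightarrow> (x, y, z) = translate_triple n t (k, 1, 0)"
      by (rule window_form) blast
    have "F (?T k) = form n k L"
      using xyz L(2) by (simp add: F(2)[OF k] d_def window_triple_def len)
    \<comment> \<open>Form I or VI at index 2 would exhibit the window as a translate of (0, 1, 2)
      or (2, 1, 0), making the cycle scalar.\<close>
    moreover have "L \<noteq> Form_I \<and> L \<noteq> Form_VI" if "k = 2"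
      using nsc tri f(2)[OF k] f_less[OF k] L(1,3,4) xyz that
      unfolding scalar_cycle_def m_def by metis
    ultimately show ?thesis by (cases L) (auto simp: edge_candidates_def)
  qed
  with F(1) have "choice_function n F" "zigzag_chromatic n F"
    using choice_zigzag_iff[OF n, of F] by auto
  moreover have "balanced n F"
  proof -
    have "in_degree n F x = out_degree n F x" for x
    proof -
      have "in_degree n F x = card {k \<in> ?C. d (Suc (f k)) = x}"
        unfolding in_degree_def edge_target_def
        by (rule arg_cong[where f = card]) (auto simp: F(2))
      \<comment> \<open>Count positions instead of classes; rotating the positions by one then turns
        targets into sources.\<close>
      also have "\<dots> = card {i \<in> {..<m}. d (Suc i mod m) = x}"
        using card_Collect_bij_betw[OF f(1), of "\<lambda>i. d (Suc i) = x"] by (simp only: d_mod)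
      also have "\<dots> = card {i \<in> {..<m}. d i = x}"
        by (rule card_Collect_bij_betw[OF bij_betw_Suc_mod])
      also have "\<dots> = card {k \<in> ?C. d (f k) = x}"
        by (rule card_Collect_bij_betw[OF f(1), symmetric])
      also have "\<dots> = out_degree n F x"
        unfolding out_degree_def edge_source_def
        by (rule arg_cong[where f = card]) (auto simp: F(2))
      finally show ?thesis .
    qed
    then show ?thesis by (simp add: balanced_def)
  qed
  moreover have "closure_sum n F = 0"
  proof -
    have "(\<Sum>k\<in>?C. edge_source n F k) = (\<Sum>k\<in>?C. d (f k))"
      by (rule sum.cong) (auto simp: edge_source_def F(2))
    also have "\<dots> = (\<Sum>i<m. d i)" by (rule sum.reindex_bij_betw[OF f(1)])
    finally have "closure_sum n F = (\<Sum>i<m. c ! (Suc i mod m) - c ! (i mod m)) mod int n"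
      by (simp add: closure_sum_def d_def mod_sum_eq)
    \<comment> \<open>Around the cycle the shifted letters are the same letters reindexed by the
      rotation, so the two sums cancel.\<close>
    also have "(\<Sum>i<m. c ! (Suc i mod m) - c ! (i mod m)) = 0"
      using sum.reindex_bij_betw[OF bij_betw_Suc_mod, of "\<lambda>i. c ! i" m]
      by (simp add: sum_subtractf)
    finally show ?thesis by simp
  qed
  ultimately show ?thesis by (intro that[of F]) (auto simp: balanced_zigzag_choices_def)
qed

section \<open>The cases \<open>n = 6\<close> and \<open>n = 12\<close>\<close>

text \<open>Every node is touched by some form of the class of index 4, which comes last, so no test
  can be made earlier.\<close>

definition order6 :: "(int \<times> int list) list" where
  "order6 = [(2, []), (3, []), (4, [1, 5, 2, 3, 4])]"

text \<open>Nodes \<open>x\<close> and \<open>-x\<close> are touched by the same classes and are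
  tested together: 2 and 10 after the indices 2, 3, 10 (index 11 is out of range), then 3 and 9,
  then 4 and 8. Nodes 1 and 11 are touched by every class and wait until the end.\<close>

definition order12 :: "(int \<times> int list) list" where
  "order12 = [(2, []), (3, []), (10, [2, 10]), (4, []), (9, [3, 9]),
     (5, []), (8, [4, 8]), (6, []), (7, [1, 11, 6, 5, 7])]"

lemma complete_orders: "complete_order 6 order6" "complete_order 12 order12"
  by code_simp+

lemma admissible_orders: "admissible (schedule 6 order6)" "admissible (schedule 12 order12)"
  by code_simp+

lemma closure_sums_6:
  "map (\<lambda>es. sum_list (map fst es) mod int 6) (search [] (schedule 6 order6)) = [4, 4, 2, 2]"
  by (simp add: balanced_at_def edge_candidates_def schedule_def order6_def)

text \<open>The congruence rule keeps pruned branches of the search unevaluated.\<close>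

lemma closure_sums_12:
  "map (\<lambda>es. sum_list (map fst es) mod int 12) (search [] (schedule 12 order12)) =
    [9, 11, 1, 3, 5, 7, 8, 4, 10, 6, 2, 10, 7, 3, 5, 10, 2, 4, 8, 6, 10, 11, 1, 9,
     2, 10, 6, 2, 8, 4, 5, 7, 9, 11, 1, 3, 2, 6, 4, 8, 10, 2, 3, 11, 1, 7, 9, 5]"
  \<comment> \<open>Three phases: the candidates become concrete residues, the search runs on
    numerals, and the sums modulo 12 are computed.\<close>
  by (simp add: edge_candidates_def schedule_def order12_def del: search.simps,
      simp only: search.simps list.pred_inject balanced_at_def list.map fst_conv snd_conv
        count_list.simps append.simps numeral_eq_iff num.inject num.distinct
        one_eq_numeral_iff numeral_eq_one_iff if_True if_False nat.inject nat.distinct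
        Suc_eq_plus1[symmetric] simp_thms cong: if_weak_cong,
      simp)

theorem proposition7p1:
  shows "card (balanced_zigzag_choices 6) = 4
    \<and> card (balanced_zigzag_choices 12) = 48
    \<and> (\<forall>F \<in> balanced_zigzag_choices 6. closure_sum 6 F \<noteq> 0)
    \<and> (\<forall>F \<in> balanced_zigzag_choices 12. closure_sum 12 F \<noteq> 0)
    \<and> closure_sum 12 ` balanced_zigzag_choices 12 = Zmod 12 - {0}
    \<and> B 6 = 0 \<and> B 12 = 0
    \<and> (\<nexists>c. zigzag_cycle 6 c) \<and> (\<nexists>c. zigzag_cycle 12 c)"
proof -
  have enum6: "card (balanced_zigzag_choices 6) = 4"
    "closure_sum 6 ` balanced_zigzag_choices 6 = {2, 4}"
    using balanced_zigzag_choices_enumeration[OF _ complete_orders(1) admissible_orders(1)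
        closure_sums_6] by auto
  have enum12: "card (balanced_zigzag_choices 12) = 48"
    "closure_sum 12 ` balanced_zigzag_choices 12 = {1, 2, 3, 4, 5, 6, 7, 8, 9, 10, 11}"
    using balanced_zigzag_choices_enumeration[OF _ complete_orders(2) admissible_orders(2)
        closure_sums_12] by auto
  have sum6: "0 \<notin> closure_sum 6 ` balanced_zigzag_choices 6"
    unfolding enum6(2) by simp
  have sum12: "0 \<notin> closure_sum 12 ` balanced_zigzag_choices 12"
    unfolding enum12(2) by simp
  have no_cycle: "\<not> zigzag_cycle n c"
    if "n \<ge> 4" "0 \<notin> closure_sum n ` balanced_zigzag_choices n" for n c
  proof
    assume "zigzag_cycle n c"
    with that(1) obtain F where "F \<in> balanced_zigzag_choices n" "closure_sum n F = 0"
      by (rule zigzag_cycle_choice)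
    then have "0 \<in> closure_sum n ` balanced_zigzag_choices n" by (metis imageI)
    with that(2) show False by contradiction
  qed
  have Zmod: "Zmod 12 - {0} = {1, 2, 3, 4, 5, 6, 7, 8, 9, 10, 11}"
    by code_simp
  have none: "\<not> zigzag_cycle 6 c" "\<not> zigzag_cycle 12 c" for c
    by (rule no_cycle[OF _ sum6], simp, rule no_cycle[OF _ sum12], simp)
  have "\<forall>F \<in> balanced_zigzag_choices 6. closure_sum 6 F \<noteq> 0"
    "\<forall>F \<in> balanced_zigzag_choices 12. closure_sum 12 F \<noteq> 0"
    using sum6 sum12 by (metis imageI)+
  \<comment> \<open>The sets counted by \<open>B\<close> are empty, so the value 0 is a genuine
    count and not the default of \<open>card\<close> on infinite sets.\<close>
  then show ?thesis
    unfolding Zmod enum12(2) using enum6(1) enum12(1) none by (simp add: B_def)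
qed

end
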